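(* Let $\mathbb{U}=\{z\in\mathbb{C}:|z|<1\}$ and let $u:\mathbb{U}\rightarrow(0,+\infty)$ be a harmonic function. Then, for all $z\in\mathbb{U}$, $$\left(\frac{1+|z|^2}{1-|z|^2}+\frac{|\nabla u(0)|}{u(0)}\frac{|z|}{1-|z|^2}\right)^{-1}\leqslant \frac{u(z)}{u(0)} \leqslant \frac{1+|z|^2}{1-|z|^2}+\frac{|\nabla u(0)|}{u(0)}\frac{|z|}{1-|z|^2}.$$
   Context: Here $\nabla u=(u_x,u_y)$ is the gradient of $u$ with respect to the real coordinates $z=x+iy$, and $|\nabla u(0)|$ is its Euclidean norm at $0$. *)

theory Defs
  imports "HOL-Complex_Analysis.Complex_Analysis"
begin

definition partial_x :: "(complex \<Rightarrow> real) \<Rightarrow> complex \<Rightarrow> real" where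
  "partial_x u z = deriv (\<lambda>x. u (Complex x (Im z))) (Re z)"

definition partial_y :: "(complex \<Rightarrow> real) \<Rightarrow> complex \<Rightarrow> real" where
  "partial_y u z = deriv (\<lambda>y. u (Complex (Re z) y)) (Im z)"

(* A pair of reals carries the Euclidean norm. *)
definition gradient :: "(complex \<Rightarrow> real) \<Rightarrow> complex \<Rightarrow> real \<times> real" where
  "gradient u z = (partial_x u z, partial_y u z)"

(* deriv is an arbitrary value where the derivative does not exist, so existence of the partial
   derivatives is required explicitly.  Both predicates are meant for open S. *)
definition C1_on :: "complex set \<Rightarrow> (complex \<Rightarrow> real) \<Rightarrow> bool" where
  "C1_on S u \<longleftrightarrow>
     (\<forall>z\<in>S. (\<lambda>x. u (Complex x (Im z))) differentiable (at (Re z)) \<and>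
            (\<lambda>y. u (Complex (Re z) y)) differentiable (at (Im z))) \<and>
     continuous_on S (partial_x u) \<and> continuous_on S (partial_y u)"

definition C2_on :: "complex set \<Rightarrow> (complex \<Rightarrow> real) \<Rightarrow> bool" where
  "C2_on S u \<longleftrightarrow> C1_on S u \<and> C1_on S (partial_x u) \<and> C1_on S (partial_y u)"

definition harmonic_on :: "complex set \<Rightarrow> (complex \<Rightarrow> real) \<Rightarrow> bool" where
  "harmonic_on S u \<longleftrightarrow> open S \<and> C2_on S u \<and>
     (\<forall>z\<in>S. partial_x (partial_x u) z + partial_y (partial_y u) z = 0)"

end

theory Submission
  imports Defs
begin

text \<open>
  The inequality is the Schwarz--Pick lemma in disguise. On the disc, which is convex, a harmonic
  \<open>u\<close> is the real part of a holomorphic \<open>F\<close> with \<open>F 0 = u 0\<close> and \<open>F' = u\<^sub>x - \<i> u\<^sub>y\<close>, so that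
  \<open>\<bar>F' 0\<bar> = \<bar>\<nabla>u 0\<bar>\<close> (\<open>harmonic_on_convex_imp_Re_holomorphic\<close>). Put \<open>a = u 0\<close>. As \<open>Re F > 0\<close>, the Cayley
  transform \<open>\<phi> = (F - a) / (F + a)\<close> maps the disc into itself and fixes the origin; hence
  \<open>\<phi> z = z h z\<close> with \<open>\<bar>h\<bar> \<le> 1\<close> and \<open>\<bar>h 0\<bar> = \<bar>\<phi>' 0\<bar> = \<bar>\<nabla>u 0\<bar> / (2 a) = c\<close>.

  The Schwarz lemma alone gives \<open>\<bar>\<phi> z\<bar> \<le> r\<close> for \<open>r = \<bar>z\<bar>\<close>, which is Harnack's inequality. Applying it once
  more, to \<open>h\<close>, gives \<open>\<bar>h z\<bar> \<le> (c + r) / (1 + c r)\<close> (\<open>Schwarz_Pick_origin\<close>), and so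
  \<open>\<bar>\<phi> z\<bar> \<le> \<rho>\<close> with \<open>\<rho> = r (c + r) / (1 + c r) < 1\<close> (\<open>positive_real_part_cayley_bound\<close>). A bound
  \<open>\<bar>F - a\<bar> \<le> \<rho> \<bar>F + a\<bar>\<close> with \<open>\<rho> \<le> 1\<close> persists for the real parts (\<open>Re_bound_of_cayley_bound\<close>), so
  \<open>u z / a\<close> lies between \<open>(1 - \<rho>) / (1 + \<rho>)\<close> and its inverse, and
  \<open>(1 + \<rho>) / (1 - \<rho>) = (1 + r\<^sup>2 + 2 c r) / (1 - r\<^sup>2)\<close> is the claimed bound.

  Holomorphy of \<open>u\<^sub>x - \<i> u\<^sub>y\<close> takes some real analysis, because harmonicity speaks of iterated partial
  derivatives only: their continuity yields total differentiability (\<open>C1_on_imp_has_derivative\<close>) and the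
  equality of the mixed ones (\<open>mixed_partials_commute\<close>), and with these the Cauchy--Riemann equations
  for \<open>u\<^sub>x - \<i> u\<^sub>y\<close> are the Laplace equation and the symmetry of the second derivatives.
\<close>

section \<open>Functions with continuous partial derivatives\<close>

text \<open>
  Partial derivatives need coordinate-parallel segments that stay inside the domain, so squares
  rather than discs are the convenient neighbourhoods.
\<close>

lemma open_complex_contains_square:
  assumes "open S" "z \<in> S"
  obtains d where "d > 0"
    "\<And>x y. \<bar>x - Re z\<bar> < d \<Longrightarrow> \<bar>y - Im z\<bar> < d \<Longrightarrow> Complex x y \<in> S"
proof -
  obtain e where e: "e > 0" "ball z e \<subseteq> S"
    using assms openE by blast
  show thesis
  proof (rule that[of "e/2"])
    show "e/2 > 0" using e by simp
    fix x y assume xy: "\<bar>x - Re z\<bar> < e/2" "\<bar>y - Im z\<bar> < e/2"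
    have "cmod (Complex x y - z) \<le> \<bar>x - Re z\<bar> + \<bar>y - Im z\<bar>"
      using cmod_le[of "Complex x y - z"] by simp
    then have "Complex x y \<in> ball z e"
      using xy by (simp add: dist_norm norm_minus_commute)
    then show "Complex x y \<in> S" using e by blast
  qed
qed

lemma C1_on_partial_derivatives:
  assumes "C1_on S u" "Complex x y \<in> S"
  shows "((\<lambda>x. u (Complex x y)) has_real_derivative partial_x u (Complex x y)) (at x)"
    and "((\<lambda>y. u (Complex x y)) has_real_derivative partial_y u (Complex x y)) (at y)"
proof -
  have "(\<lambda>x. u (Complex x y)) differentiable (at x)" "(\<lambda>y. u (Complex x y)) differentiable (at y)"
    using assms unfolding C1_on_def by force+
  then show "((\<lambda>x. u (Complex x y)) has_real_derivative partial_x u (Complex x y)) (at x)"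
    "((\<lambda>y. u (Complex x y)) has_real_derivative partial_y u (Complex x y)) (at y)"
    unfolding partial_x_def partial_y_def
    by (simp_all add: DERIV_deriv_iff_real_differentiable)
qed

text \<open>
  Existence of the partial derivatives alone would not suffice; continuity of one of them
  (here \<open>partial_y u\<close>) near \<open>z\<close> makes the linearisation in \<open>y\<close> uniform in \<open>x\<close>.
\<close>

lemma C1_on_imp_has_derivative:
  assumes C1: "C1_on S u" and S: "open S" and z: "z \<in> S"
  shows "(u has_derivative (\<lambda>h. partial_x u z * Re h + partial_y u z * Im h)) (at z)"
proof -
  obtain d where d: "d > 0"
    "\<And>x y. \<bar>x - Re z\<bar> < d \<Longrightarrow> \<bar>y - Im z\<bar> < d \<Longrightarrow> Complex x y \<in> S"
    using open_complex_contains_square[OF S z] by blast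
  define X Y where "X = ball (Re z) d" and "Y = ball (Im z) d"
  have inS: "Complex x y \<in> S" if "x \<in> X" "y \<in> Y" for x y
    using that d by (simp add: X_def Y_def dist_real_def abs_minus_commute)
  have zXY: "Re z \<in> X" "Im z \<in> Y" using d by (auto simp: X_def Y_def)
  let ?f = "\<lambda>x y. u (Complex x y)"
  let ?fy = "\<lambda>x y. blinfun_mult_right (partial_y u (Complex x y))"
  have "((\<lambda>(x, y). ?f x y) has_derivative
          (\<lambda>(tx, ty). partial_x u z * tx + ?fy (Re z) (Im z) ty)) (at (Re z, Im z) within X \<times> Y)"
  proof (rule has_derivative_partialsI)
    show "((\<lambda>x. ?f x (Im z)) has_derivative (*) (partial_x u z)) (at (Re z) within X)"
      using C1_on_partial_derivatives(1)[OF C1, of "Re z" "Im z"] z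
      by (auto simp: has_field_derivative_def intro: has_derivative_at_withinI)
    show "((\<lambda>y. ?f x y) has_derivative blinfun_apply (?fy x y)) (at y within Y)"
      if "x \<in> X" "y \<in> Y" for x y
      using C1_on_partial_derivatives(2)[OF C1 inS[OF that]]
      by (auto simp: has_field_derivative_def intro: has_derivative_at_withinI)
    have "continuous_on (X \<times> Y) (\<lambda>p. partial_y u (Complex (fst p) (snd p)))"
    proof (rule continuous_on_compose2[of S "partial_y u" "X \<times> Y" "\<lambda>p. Complex (fst p) (snd p)"])
      show "continuous_on S (partial_y u)" using C1 by (simp add: C1_on_def)
      show "continuous_on (X \<times> Y) (\<lambda>p. Complex (fst p) (snd p))"
        unfolding Complex_eq by (intro continuous_intros)
      show "(\<lambda>p. Complex (fst p) (snd p)) ` (X \<times> Y) \<subseteq> S" using inS by auto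
    qed
    then have "continuous_on (X \<times> Y) (\<lambda>(x, y). ?fy x y)"
      by (auto simp: split_beta' intro!: bounded_linear.continuous_on[OF bounded_linear_blinfun_mult_right])
    then show "continuous (at (Re z, Im z) within X \<times> Y) (\<lambda>(x, y). ?fy x y)"
      using zXY by (simp add: continuous_on_eq_continuous_within)
    show "Im z \<in> Y" "convex Y" using zXY by (auto simp: Y_def)
  qed
  moreover have "open (X \<times> Y)" by (simp add: X_def Y_def open_Times)
  ultimately have D: "((\<lambda>(x, y). ?f x y) has_derivative
      (\<lambda>(tx, ty). partial_x u z * tx + partial_y u z * ty)) (at (Re z, Im z))"
    using zXY by (simp add: at_within_open[of _ "X \<times> Y"] blinfun_mult_right.rep_eq)
  have E: "((\<lambda>w. (Re w, Im w)) has_derivative (\<lambda>h. (Re h, Im h))) (at z)"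
    by (intro has_derivative_Pair bounded_linear_imp_has_derivative bounded_linear_Re bounded_linear_Im)
  show ?thesis
    using has_derivative_compose[OF E D] by simp
qed

text \<open>
  The second difference over a square is unchanged when the two coordinates swap roles, while the
  mean value theorem, applied first in \<open>x\<close> and then in \<open>y\<close>, expresses it by the mixed derivative taken in
  that order. Comparing both orders is what makes mixed partial derivatives agree.
\<close>

lemma second_difference_mean_value:
  fixes f fx fxy :: "real \<Rightarrow> real \<Rightarrow> real"
  assumes h: "h > 0"
    and fx: "\<And>x y. x \<in> {a..a+h} \<Longrightarrow> y \<in> {b..b+h} \<Longrightarrow> ((\<lambda>x. f x y) has_real_derivative fx x y) (at x)"
    and fxy: "\<And>x y. x \<in> {a..a+h} \<Longrightarrow> y \<in> {b..b+h} \<Longrightarrow> (fx x has_real_derivative fxy x y) (at y)"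
  obtains x y where "x \<in> {a..a+h}" "y \<in> {b..b+h}"
    "f (a+h) (b+h) - f (a+h) b - f a (b+h) + f a b = h\<^sup>2 * fxy x y"
proof -
  have "\<exists>x. a < x \<and> x < a+h \<and>
      (f (a+h) (b+h) - f (a+h) b) - (f a (b+h) - f a b) = (a+h-a) * (fx x (b+h) - fx x b)"
    using h by (intro MVT2[where f="\<lambda>x. f x (b+h) - f x b"]) (auto intro!: DERIV_diff fx)
  then obtain x where x: "a < x" "x < a+h"
    "(f (a+h) (b+h) - f (a+h) b) - (f a (b+h) - f a b) = h * (fx x (b+h) - fx x b)"
    by auto
  have "\<exists>y. b < y \<and> y < b+h \<and> fx x (b+h) - fx x b = (b+h-b) * fxy x y"
    using h x by (intro MVT2) (auto intro!: fxy)
  then obtain y where y: "b < y" "y < b+h" "fx x (b+h) - fx x b = h * fxy x y"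
    by auto
  show thesis
    using x y by (intro that[of x y]) (auto simp: power2_eq_square algebra_simps)
qed

text \<open>
  Over squares at \<open>z\<close> of side \<open>h n \<longlonglongrightarrow> 0\<close> the second difference, divided by the area, is a value of one mixed
  derivative at a point \<open>p n\<close> and of the other at a point \<open>q n\<close> of the square. Both sequences tend to \<open>z\<close>,
  and the mixed derivatives are continuous.
\<close>

lemma mixed_partials_commute:
  assumes C2: "C2_on S u" and S: "open S" and z: "z \<in> S"
  shows "partial_x (partial_y u) z = partial_y (partial_x u) z"
proof -
  have C1: "C1_on S u" "C1_on S (partial_x u)" "C1_on S (partial_y u)"
    using C2 by (auto simp: C2_on_def)
  obtain d where d: "d > 0"
    "\<And>x y. \<bar>x - Re z\<bar> < d \<Longrightarrow> \<bar>y - Im z\<bar> < d \<Longrightarrow> Complex x y \<in> S"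
    using open_complex_contains_square[OF S z] by blast
  define h where "h n = d / 2 / real (Suc n)" for n
  have h0: "h n > 0" and hd: "h n < d" for n
  proof -
    show "h n > 0" using d by (simp add: h_def)
    have "h n \<le> d / 2" using d by (simp add: h_def divide_le_eq)
    then show "h n < d" using d by simp
  qed
  have h_lim: "h \<longlonglongrightarrow> 0"
    unfolding h_def using LIMSEQ_Suc[OF lim_const_over_n[of "d/2"]] by simp
  define \<Delta> where "\<Delta> n = u (Complex (Re z + h n) (Im z + h n)) - u (Complex (Re z + h n) (Im z))
      - u (Complex (Re z) (Im z + h n)) + u z" for n
  have inS: "Complex x y \<in> S" if "x \<in> {Re z..Re z + h n}" "y \<in> {Im z..Im z + h n}" for x y n
    using that hd[of n] by (intro d(2)) auto
  have "\<exists>p. Re p \<in> {Re z..Re z + h n} \<and> Im p \<in> {Im z..Im z + h n} \<and>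
      \<Delta> n = (h n)\<^sup>2 * partial_y (partial_x u) p" for n
  proof -
    obtain x y where "x \<in> {Re z..Re z + h n}" "y \<in> {Im z..Im z + h n}"
      "u (Complex (Re z + h n) (Im z + h n)) - u (Complex (Re z + h n) (Im z))
       - u (Complex (Re z) (Im z + h n)) + u (Complex (Re z) (Im z))
       = (h n)\<^sup>2 * partial_y (partial_x u) (Complex x y)"
      using second_difference_mean_value[OF h0[of n],
          where f="\<lambda>x y. u (Complex x y)" and fx="\<lambda>x y. partial_x u (Complex x y)"
            and fxy="\<lambda>x y. partial_y (partial_x u) (Complex x y)" and a="Re z" and b="Im z"]
        C1_on_partial_derivatives(1)[OF C1(1) inS] C1_on_partial_derivatives(2)[OF C1(2) inS]
      by metis
    then show ?thesis by (intro exI[of _ "Complex x y"]) (auto simp: \<Delta>_def)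
  qed
  then obtain p where p: "\<And>n. Re (p n) \<in> {Re z..Re z + h n}" "\<And>n. Im (p n) \<in> {Im z..Im z + h n}"
    "\<And>n. \<Delta> n = (h n)\<^sup>2 * partial_y (partial_x u) (p n)"
    by metis
  have "\<exists>q. Re q \<in> {Re z..Re z + h n} \<and> Im q \<in> {Im z..Im z + h n} \<and>
      \<Delta> n = (h n)\<^sup>2 * partial_x (partial_y u) q" for n
  proof -
    \<comment> \<open>the same mean value argument with the coordinates interchanged\<close>
    obtain x y where "y \<in> {Im z..Im z + h n}" "x \<in> {Re z..Re z + h n}"
      "u (Complex (Re z + h n) (Im z + h n)) - u (Complex (Re z) (Im z + h n))
       - u (Complex (Re z + h n) (Im z)) + u (Complex (Re z) (Im z))
       = (h n)\<^sup>2 * partial_x (partial_y u) (Complex x y)"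
      using second_difference_mean_value[OF h0[of n],
          where f="\<lambda>y x. u (Complex x y)" and fx="\<lambda>y x. partial_y u (Complex x y)"
            and fxy="\<lambda>y x. partial_x (partial_y u) (Complex x y)" and a="Im z" and b="Re z"]
        C1_on_partial_derivatives(2)[OF C1(1) inS] C1_on_partial_derivatives(1)[OF C1(3) inS]
      by metis
    then show ?thesis by (intro exI[of _ "Complex x y"]) (auto simp: \<Delta>_def)
  qed
  then obtain q where q: "\<And>n. Re (q n) \<in> {Re z..Re z + h n}" "\<And>n. Im (q n) \<in> {Im z..Im z + h n}"
    "\<And>n. \<Delta> n = (h n)\<^sup>2 * partial_x (partial_y u) (q n)"
    by metis
  have squeeze: "s \<longlonglongrightarrow> z \<and> (\<forall>n. s n \<in> S)"
    if s: "\<And>n. Re (s n) \<in> {Re z..Re z + h n}" "\<And>n. Im (s n) \<in> {Im z..Im z + h n}" for s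
  proof -
    have up: "(\<lambda>n. t + h n) \<longlonglongrightarrow> t" for t
      using tendsto_add[OF tendsto_const h_lim, of t] by simp
    have "(\<lambda>n. Re (s n)) \<longlonglongrightarrow> Re z" "(\<lambda>n. Im (s n)) \<longlonglongrightarrow> Im z"
      by (rule tendsto_sandwich[OF _ _ tendsto_const up]; use s in auto)+
    moreover have "s n \<in> S" for n
      using inS[OF s] by simp
    ultimately show ?thesis by (simp add: tendsto_complex_iff)
  qed
  have cont: "continuous_on S (partial_y (partial_x u))" "continuous_on S (partial_x (partial_y u))"
    using C1 by (auto simp: C1_on_def)
  have "(\<lambda>n. partial_y (partial_x u) (p n)) \<longlonglongrightarrow> partial_y (partial_x u) z"
    using continuous_on_tendsto_compose[OF cont(1), of p] squeeze[of p] p z by auto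
  moreover have "(\<lambda>n. partial_x (partial_y u) (q n)) \<longlonglongrightarrow> partial_x (partial_y u) z"
    using continuous_on_tendsto_compose[OF cont(2), of q] squeeze[of q] q z by auto
  moreover have "partial_y (partial_x u) (p n) = partial_x (partial_y u) (q n)" for n
    using p(3)[of n] q(3)[of n] h0[of n] by simp
  ultimately show ?thesis
    using LIMSEQ_unique by simp
qed

section \<open>Harmonic functions as real parts\<close>

text \<open>
  Of the Cauchy--Riemann equations for the pair \<open>(u\<^sub>x, - u\<^sub>y)\<close>, one is the Laplace equation and the other
  is the symmetry of the mixed partial derivatives.
\<close>

lemma harmonic_on_complex_gradient_holomorphic:
  assumes "harmonic_on S u"
  shows "(\<lambda>z. Complex (partial_x u z) (- partial_y u z)) holomorphic_on S"
proof -
  have S: "open S" and C2: "C2_on S u"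
    and lap: "\<And>z. z \<in> S \<Longrightarrow> partial_x (partial_x u) z + partial_y (partial_y u) z = 0"
    using assms by (auto simp: harmonic_on_def)
  have C1: "C1_on S (partial_x u)" "C1_on S (partial_y u)"
    using C2 by (auto simp: C2_on_def)
  have "((\<lambda>z. Complex (partial_x u z) (- partial_y u z)) has_field_derivative
      Complex (partial_x (partial_x u) z) (- partial_x (partial_y u) z)) (at z)" if z: "z \<in> S" for z
  proof -
    have yy: "partial_y (partial_y u) z = - partial_x (partial_x u) z"
      using lap[OF z] by linarith
    note xy = mixed_partials_commute[OF C2 S z, symmetric]
    have "((\<lambda>z. of_real (partial_x u z) - \<i> * of_real (partial_y u z)) has_derivative
       (\<lambda>h. of_real (partial_x (partial_x u) z * Re h + partial_y (partial_x u) z * Im h)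
          - \<i> * of_real (partial_x (partial_y u) z * Re h + partial_y (partial_y u) z * Im h))) (at z)"
      by (intro has_derivative_diff has_derivative_mult_right has_derivative_of_real
          C1_on_imp_has_derivative[OF C1(1) S z] C1_on_imp_has_derivative[OF C1(2) S z])
    moreover have "(\<lambda>z. of_real (partial_x u z) - \<i> * of_real (partial_y u z))
        = (\<lambda>z. Complex (partial_x u z) (- partial_y u z))"
      by (simp add: fun_eq_iff complex_eq_iff)
    moreover have "(\<lambda>h. of_real (partial_x (partial_x u) z * Re h + partial_y (partial_x u) z * Im h)
          - \<i> * of_real (partial_x (partial_y u) z * Re h + partial_y (partial_y u) z * Im h))
        = (*) (Complex (partial_x (partial_x u) z) (- partial_x (partial_y u) z))"
      by (simp add: fun_eq_iff complex_eq_iff xy yy)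
    ultimately show ?thesis
      by (simp add: has_field_derivative_def)
  qed
  then show ?thesis
    using S holomorphic_on_open by blast
qed

text \<open>
  Any primitive \<open>F\<close> of \<open>u\<^sub>x - \<i> u\<^sub>y\<close> satisfies \<open>Re (F' h) = u\<^sub>x Re h + u\<^sub>y Im h\<close>, so \<open>Re F\<close> and \<open>u\<close> have the same
  derivative and differ by a constant. The free additive constant of \<open>F\<close> is spent on prescribing a
  real value at \<open>w\<close>.
\<close>

lemma harmonic_on_convex_imp_Re_holomorphic:
  assumes harm: "harmonic_on S u" and "convex S" and w: "w \<in> S"
  obtains F where "F holomorphic_on S" "\<And>z. z \<in> S \<Longrightarrow> Re (F z) = u z"
    "\<And>z. z \<in> S \<Longrightarrow> deriv F z = Complex (partial_x u z) (- partial_y u z)"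
    "F w = of_real (u w)"
proof -
  let ?g = "\<lambda>z. Complex (partial_x u z) (- partial_y u z)"
  have S: "open S" and C1: "C1_on S u"
    using harm unfolding harmonic_on_def C2_on_def by blast+
  obtain G where "\<And>z. z \<in> S \<Longrightarrow> (G has_field_derivative ?g z) (at z within S)"
    using holomorphic_convex_primitive'[OF \<open>convex S\<close> S harmonic_on_complex_gradient_holomorphic[OF harm]]
    by blast
  then have G: "(G has_field_derivative ?g z) (at z)" if "z \<in> S" for z
    using that S by (metis at_within_open)
  define F where "F z = G z - G w + of_real (u w)" for z
  have F: "(F has_field_derivative ?g z) (at z)" if "z \<in> S" for z
    unfolding F_def using G[OF that] by (auto intro!: derivative_eq_intros)
  have "((\<lambda>z. Re (F z) - u z) has_derivative (\<lambda>h. 0)) (at z within S)" if z: "z \<in> S" for z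
  proof -
    have "((\<lambda>z. Re (F z) - u z) has_derivative
        (\<lambda>h. Re (?g z * h) - (partial_x u z * Re h + partial_y u z * Im h))) (at z)"
      using F[OF z] unfolding has_field_derivative_def
      by (intro has_derivative_diff has_derivative_Re C1_on_imp_has_derivative[OF C1 S z])
    then show ?thesis
      by (simp add: has_derivative_at_withinI)
  qed
  then obtain c where c: "\<And>z. z \<in> S \<Longrightarrow> Re (F z) - u z = c"
    using has_derivative_zero_constant[OF \<open>convex S\<close>, of "\<lambda>z. Re (F z) - u z"] by blast
  show thesis
  proof (rule that[of F])
    show "F holomorphic_on S"
      using F S holomorphic_on_open by blast
    show "Re (F z) = u z" if "z \<in> S" for z
      using c[OF that] c[OF w] by (simp add: F_def)
    show "deriv F z = ?g z" if "z \<in> S" for z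
      using F[OF that] by (rule DERIV_imp_deriv)
    show "F w = of_real (u w)" by (simp add: F_def)
  qed
qed

section \<open>Schwarz--Pick estimates\<close>

text \<open>
  The Schwarz lemma for the composition of \<open>h\<close> with the disc automorphism taking \<open>b = h 0\<close> to \<open>0\<close> says
  \<open>\<bar>h z - b\<bar> \<le> \<bar>z\<bar> \<bar>1 - cnj b h z\<bar>\<close>. Squaring and using \<open>Re (cnj b h z) \<le> \<bar>b\<bar> \<bar>h z\<bar>\<close> removes the arguments and
  leaves \<open>\<bar>h z\<bar> - \<bar>b\<bar> \<le> \<bar>z\<bar> (1 - \<bar>b\<bar> \<bar>h z\<bar>)\<close>, which is the claim. Values of modulus \<open>1\<close> are admitted for \<open>h\<close> because
  \<open>\<phi> z / z\<close> attains them when \<open>\<phi>\<close> is a rotation.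
\<close>

lemma Schwarz_Pick_origin:
  assumes hol: "h holomorphic_on ball 0 1"
    and le1: "\<And>z. cmod z < 1 \<Longrightarrow> cmod (h z) \<le> 1" and z: "cmod z < 1"
  shows "cmod (h z) * (1 + cmod (h 0) * cmod z) \<le> cmod (h 0) + cmod z"
proof (cases "cmod (h 0) = 1")
  case True
  then show ?thesis
    using le1[OF z] mult_right_mono[OF le1[OF z], of "1 + cmod z"] by simp
next
  case False
  with le1[of 0] have c: "cmod (h 0) < 1" by simp
  \<comment> \<open>a value on the unit circle would force \<open>h\<close> to be constant, contradicting \<open>\<bar>h 0\<bar> < 1\<close>\<close>
  have lt1: "cmod (h w) < 1" if w: "cmod w < 1" for w
  proof (rule ccontr)
    assume "\<not> cmod (h w) < 1"
    with le1[OF w] have hw: "cmod (h w) = 1" by simp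
    have "h constant_on ball 0 1"
      by (rule maximum_modulus_principle[OF hol, of "ball 0 1" w]) (use w le1 hw in auto)
    then show False
      using w hw c by (force simp: constant_on_def)
  qed
  define b where "b = h 0"
  define k where "k w = (h w - b) / (1 - cnj b * h w)" for w
  have den: "1 - cnj b * h w \<noteq> 0" if "cmod w < 1" for w
  proof
    assume "1 - cnj b * h w = 0"
    then have "cmod b * cmod (h w) = 1"
      by (metis complex_mod_cnj eq_iff_diff_eq_0 norm_mult norm_one)
    moreover have "cmod b * cmod (h w) < 1 * 1"
      using c lt1[OF that] by (intro mult_strict_mono') (auto simp: b_def)
    ultimately show False by simp
  qed
  have id: "(cmod (1 - cnj b * h w))\<^sup>2 - (cmod (h w - b))\<^sup>2 = (1 - (cmod b)\<^sup>2) * (1 - (cmod (h w))\<^sup>2)" for w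
    unfolding cmod_power2 by (simp add: power2_eq_square algebra_simps)
  have "cmod (k z) \<le> cmod z"
  proof (rule Schwarz_Lemma(1)[OF _ _ _ z])
    show "k holomorphic_on ball 0 1"
      unfolding k_def using den by (intro holomorphic_intros hol) auto
    show "k 0 = 0" by (simp add: k_def b_def)
    fix w :: complex assume w: "cmod w < 1"
    have "(1 - (cmod b)\<^sup>2) * (1 - (cmod (h w))\<^sup>2) > 0"
      using c lt1[OF w] by (intro mult_pos_pos) (auto simp: b_def power_less_one_iff)
    then have "(cmod (h w - b))\<^sup>2 < (cmod (1 - cnj b * h w))\<^sup>2"
      using id[of w] by linarith
    then have "cmod (h w - b) < cmod (1 - cnj b * h w)"
      using power_less_imp_less_base norm_ge_zero by blast
    then show "cmod (k w) < 1"
      using den[OF w] by (simp add: k_def norm_divide divide_less_eq)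
  qed
  then have "cmod (h z - b) \<le> cmod z * cmod (1 - cnj b * h z)"
    using den[OF z] by (simp add: k_def norm_divide divide_le_eq)
  then have sq: "(cmod (h z - b))\<^sup>2 \<le> (cmod z)\<^sup>2 * (cmod (1 - cnj b * h z))\<^sup>2"
    by (simp add: power_mult_distrib[symmetric] power_mono)
  define r s t where "r = cmod z" and "s = cmod b" and "t = cmod (h z)"
  define m where "m = Re (cnj b * h z)"
  have m: "m \<le> s * t"
    unfolding m_def s_def t_def using complex_Re_le_cmod[of "cnj b * h z"] by (simp add: norm_mult)
  have 1: "(cmod (h z - b))\<^sup>2 = t\<^sup>2 + s\<^sup>2 - 2 * m"
    unfolding m_def s_def t_def cmod_power2 by (simp add: power2_eq_square algebra_simps)
  have 2: "(cmod (1 - cnj b * h z))\<^sup>2 = 1 + s\<^sup>2 * t\<^sup>2 - 2 * m"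
    unfolding m_def s_def t_def cmod_power2 by (simp add: power2_eq_square algebra_simps)
  have r: "0 \<le> r" "r\<^sup>2 \<le> 1" and st: "s * t \<le> 1"
    using z c lt1[OF z] by (auto simp: r_def s_def t_def b_def power_le_one mult_le_one)
  have "2 * m * (1 - r\<^sup>2) \<le> 2 * (s * t) * (1 - r\<^sup>2)"
    using m r by (intro mult_right_mono) auto
  then have "(t - s)\<^sup>2 \<le> (r * (1 - s * t))\<^sup>2"
    using sq unfolding 1 2 r_def[symmetric] by (simp add: power2_eq_square algebra_simps)
  then have "t - s \<le> r * (1 - s * t)"
    using r st by (simp add: abs_le_square_iff[symmetric] abs_mult)
  then show ?thesis
    by (simp add: r_def s_def t_def b_def algebra_simps)
qed

text \<open>
  The Cayley transform \<open>\<phi> = (F - a) / (F + a)\<close> sends the right half-plane to the disc and \<open>F 0 = a\<close> to \<open>0\<close>.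
  Dividing it by \<open>z\<close> leaves a function \<open>h\<close> bounded by \<open>1\<close> whose value at \<open>0\<close> is \<open>\<phi>' 0 = F' 0 / (2 a)\<close>;
  this is where the derivative at the origin enters. The conclusion is \<open>\<bar>\<phi> z\<bar> \<le> r (c + r) / (1 + c r)\<close>, with
  \<open>r = \<bar>z\<bar>\<close>, cleared of denominators.
\<close>

lemma positive_real_part_cayley_bound:
  assumes hol: "F holomorphic_on ball 0 1"
    and pos: "\<And>z. cmod z < 1 \<Longrightarrow> Re (F z) > 0"
    and F0: "F 0 = of_real a" and z: "cmod z < 1"
  defines "c \<equiv> cmod (deriv F 0) / (2 * a)"
  shows "cmod (F z - of_real a) * (1 + c * cmod z) \<le> cmod z * (c + cmod z) * cmod (F z + of_real a)"
proof -
  have a: "a > 0" using pos[of 0] F0 by simp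
  define \<phi> where "\<phi> w = (F w - of_real a) / (F w + of_real a)" for w
  have den: "F w + of_real a \<noteq> 0" if "cmod w < 1" for w
    using pos[OF that] a by (auto simp: complex_eq_iff)
  have hol\<phi>: "\<phi> holomorphic_on ball 0 1"
    unfolding \<phi>_def using den by (intro holomorphic_intros hol) auto
  have \<phi>0: "\<phi> 0 = 0" by (simp add: \<phi>_def F0)
  have \<phi>1: "cmod (\<phi> w) < 1" if w: "cmod w < 1" for w
  proof -
    have "(cmod (F w + of_real a))\<^sup>2 - (cmod (F w - of_real a))\<^sup>2 = 4 * a * Re (F w)"
      unfolding cmod_power2 by (simp add: power2_eq_square algebra_simps)
    moreover have "4 * a * Re (F w) > 0" using a pos[OF w] by simp
    ultimately have "(cmod (F w - of_real a))\<^sup>2 < (cmod (F w + of_real a))\<^sup>2"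
      by linarith
    then have "cmod (F w - of_real a) < cmod (F w + of_real a)"
      using power_less_imp_less_base norm_ge_zero by blast
    then show ?thesis
      using den[OF w] by (simp add: \<phi>_def norm_divide divide_less_eq)
  qed
  obtain h where h: "h holomorphic_on ball 0 1" "\<And>w. cmod w < 1 \<Longrightarrow> \<phi> w = w * h w"
    "deriv \<phi> 0 = h 0"
    using Schwarz3[OF hol\<phi> \<phi>0] by blast
  have h1: "cmod (h w) \<le> 1" if w: "cmod w < 1" for w
  proof (cases "w = 0")
    case True
    then show ?thesis using Schwarz_Lemma(2)[OF hol\<phi> \<phi>0 \<phi>1 w] h(3) by simp
  next
    case False
    have "cmod w * cmod (h w) \<le> cmod w * 1"
      using Schwarz_Lemma(1)[OF hol\<phi> \<phi>0 \<phi>1 w] h(2)[OF w] by (simp add: norm_mult)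
    then show ?thesis using False by (simp add: mult_le_cancel_left)
  qed
  have "(F has_field_derivative deriv F 0) (at 0)"
    using hol by (intro holomorphic_derivI[of _ "ball 0 1"]) auto
  then have "(\<phi> has_field_derivative deriv F 0 / (2 * of_real a)) (at 0)"
    unfolding \<phi>_def using a
    by (auto intro!: derivative_eq_intros simp: F0 field_simps)
  then have h0: "cmod (h 0) = c"
    using a DERIV_imp_deriv[of \<phi>] by (simp add: h(3)[symmetric] c_def norm_divide norm_mult)
  have "cmod (\<phi> z) * (1 + c * cmod z) = cmod z * (cmod (h z) * (1 + c * cmod z))"
    by (simp add: h(2)[OF z] norm_mult)
  also have "\<dots> \<le> cmod z * (c + cmod z)"
    using Schwarz_Pick_origin[OF h(1) h1 z] h0 by (intro mult_left_mono) auto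
  finally have "cmod (\<phi> z) * (1 + c * cmod z) * cmod (F z + of_real a)
      \<le> cmod z * (c + cmod z) * cmod (F z + of_real a)"
    by (intro mult_right_mono) auto
  also have "cmod (\<phi> z) * (1 + c * cmod z) * cmod (F z + of_real a)
      = cmod (F z - of_real a) * (1 + c * cmod z)"
    using den[OF z] by (simp add: \<phi>_def norm_divide)
  finally show ?thesis .
qed

text \<open>
  The numbers \<open>w - a\<close> and \<open>w + a\<close> have the same imaginary part, and its square carries the weight \<open>q\<^sup>2\<close> on the
  smaller side and \<open>p\<^sup>2 \<le> q\<^sup>2\<close> on the larger one, so dropping it preserves the inequality.
\<close>

lemma Re_bound_of_cayley_bound:
  assumes le: "cmod (w - of_real a) * q \<le> p * cmod (w + of_real a)"
    and pq: "0 \<le> p" "p \<le> q" "q > 0" and x: "Re w + a > 0"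
  shows "\<bar>Re w - a\<bar> * q \<le> p * (Re w + a)"
proof -
  have "(cmod (w - of_real a) * q)\<^sup>2 \<le> (p * cmod (w + of_real a))\<^sup>2"
    using le pq by (intro power_mono) auto
  then have *: "((Re w - a)\<^sup>2 + (Im w)\<^sup>2) * q\<^sup>2 \<le> p\<^sup>2 * ((Re w + a)\<^sup>2 + (Im w)\<^sup>2)"
    by (simp add: power_mult_distrib cmod_power2)
  have "p\<^sup>2 * (Im w)\<^sup>2 \<le> q\<^sup>2 * (Im w)\<^sup>2"
    using pq by (intro mult_right_mono power_mono) auto
  with * have "(Re w - a)\<^sup>2 * q\<^sup>2 \<le> p\<^sup>2 * (Re w + a)\<^sup>2"
    by (simp add: distrib_left distrib_right mult.commute)
  then have "((Re w - a) * q)\<^sup>2 \<le> (p * (Re w + a))\<^sup>2"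
    by (simp add: power_mult_distrib)
  then have "\<bar>(Re w - a) * q\<bar> \<le> \<bar>p * (Re w + a)\<bar>"
    by (simp add: abs_le_square_iff)
  then show ?thesis
    using pq x by (simp add: abs_mult)
qed

section \<open>The sharpened Harnack inequality\<close>

theorem theorem1:
  fixes u :: "complex \<Rightarrow> real"
  assumes harm: "harmonic_on (ball 0 1) u"
    and pos: "\<And>z. z \<in> ball 0 1 \<Longrightarrow> u z > 0"
  shows "\<forall>z\<in>ball 0 1.
      inverse ((1 + (cmod z)\<^sup>2) / (1 - (cmod z)\<^sup>2)
               + norm (gradient u 0) / u 0 * (cmod z / (1 - (cmod z)\<^sup>2))) \<le> u z / u 0 \<and>
      u z / u 0 \<le> (1 + (cmod z)\<^sup>2) / (1 - (cmod z)\<^sup>2)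
               + norm (gradient u 0) / u 0 * (cmod z / (1 - (cmod z)\<^sup>2))"
proof
  fix z :: complex assume zB: "z \<in> ball 0 1"
  obtain F where F: "F holomorphic_on ball 0 1" "\<And>z. z \<in> ball 0 1 \<Longrightarrow> Re (F z) = u z"
    "\<And>z. z \<in> ball 0 1 \<Longrightarrow> deriv F z = Complex (partial_x u z) (- partial_y u z)"
    "F 0 = of_real (u 0)"
    using harmonic_on_convex_imp_Re_holomorphic[OF harm convex_ball, of 0] by (metis centre_in_ball zero_less_one)
  define a r c where "a = u 0" and "r = cmod z" and "c = norm (gradient u 0) / (2 * a)"
  have r: "0 \<le> r" "r < 1" using zB by (auto simp: r_def)
  have r2: "r\<^sup>2 < 1" using r by (simp add: power_less_one_iff)
  have a: "a > 0" and uz: "u z > 0" using pos zB by (auto simp: a_def)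
  have c: "c \<ge> 0" using a by (simp add: c_def)
  have grad: "norm (gradient u 0) = cmod (deriv F 0)"
    by (simp add: F(3) gradient_def norm_prod_def cmod_def)
  have "cmod (F z - of_real a) * (1 + c * r) \<le> r * (c + r) * cmod (F z + of_real a)"
    using positive_real_part_cayley_bound[OF F(1) _ F(4), of z] pos F(2) zB
    by (simp add: grad a_def r_def c_def)
  then have "\<bar>Re (F z) - a\<bar> * (1 + c * r) \<le> r * (c + r) * (Re (F z) + a)"
  proof (rule Re_bound_of_cayley_bound)
    \<comment> \<open>equivalent to \<open>r\<^sup>2 \<le> 1\<close>\<close>
    show "r * (c + r) \<le> 1 + c * r" using r2 by (simp add: power2_eq_square algebra_simps)
    show "Re (F z) + a > 0" using a uz F(2)[OF zB] by simp
    show "1 + c * r > 0" using c r by (simp add: add_pos_nonneg)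
  qed (use c r in auto)
  moreover have "1 + c * r \<ge> 0" using c r by simp
  ultimately have
    "(u z - a) * (1 + c * r) \<le> r * (c + r) * (u z + a)"
    "(a - u z) * (1 + c * r) \<le> r * (c + r) * (u z + a)"
    using F(2)[OF zB]
    by (smt (verit) mult_right_mono)+
  \<comment> \<open>the coefficients are \<open>(1 + c r) \<mp> r (c + r)\<close>\<close>
  then have upper: "u z * (1 - r\<^sup>2) \<le> a * (1 + r\<^sup>2 + 2 * c * r)"
    and lower: "a * (1 - r\<^sup>2) \<le> u z * (1 + r\<^sup>2 + 2 * c * r)"
    by (simp_all add: power2_eq_square algebra_simps)
  define K where "K = (1 + r\<^sup>2 + 2 * c * r) / (1 - r\<^sup>2)"
  have num: "1 + r\<^sup>2 + 2 * c * r > 0"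
    using c r by (intro add_pos_nonneg) auto
  have K: "(1 + (cmod z)\<^sup>2) / (1 - (cmod z)\<^sup>2)
               + norm (gradient u 0) / u 0 * (cmod z / (1 - (cmod z)\<^sup>2)) = K"
    using a by (simp add: K_def r_def c_def a_def add_divide_distrib)
  have "u z / a \<le> K"
    using upper a r2 by (simp add: K_def field_simps)
  moreover have "inverse K \<le> u z / a"
    using lower a r2 num by (simp add: K_def field_simps)
  ultimately show "inverse ((1 + (cmod z)\<^sup>2) / (1 - (cmod z)\<^sup>2)
               + norm (gradient u 0) / u 0 * (cmod z / (1 - (cmod z)\<^sup>2))) \<le> u z / u 0 \<and>
      u z / u 0 \<le> (1 + (cmod z)\<^sup>2) / (1 - (cmod z)\<^sup>2)
               + norm (gradient u 0) / u 0 * (cmod z / (1 - (cmod z)\<^sup>2))"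
    unfolding K by (simp add: a_def)
qed

end
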